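(* Let $q$ be a prime power, let $k\ge 2$, and let $\overline{\mathcal{M}}\colon\mathcal{P}\to\{0,1\}$ be a set of points in $\operatorname{PG}(k-1,q)$ with $r:=\#\overline{\mathcal{M}}\notin\{0,[k]_q\}$. Put $$\mathcal{M}:=\sum_{H\in\mathcal{H}}\overline{\mathcal{M}}(H^\perp)\cdot\chi_H .$$ Then: (1) $\mathcal{M}$ is a two-character multiset corresponding to the pair $(s,t)\in\mathbb{L}(\overline{\mathcal{M}})$ with $t=r[k-2]_q$ and $s=r[k-2]_q+q^{k-2}$, and it has cardinality $\#\mathcal{M}=r[k-1]_q$. (2) Let $\mu:=\min_{P\in\mathcal{P}}\mathcal{M}(P)$ and $g:=\gcd\left(\{\mathcal{M}(P)-\mu : P\in\mathcal{P}\}\right)$. Then $g$ divides $q^{k-2}$, and the function $$\mathcal{M}':=\frac1g\cdot\left(\mathcal{M}-\mu\cdot\chi_V\right)$$ is a two-character multiset corresponding to the pair $(s_0,t_0)\in\mathbb{L}(\overline{\mathcal{M}})$ with $$t_0=\tfrac1g\left(r[k-2]_q-\mu[k-1]_q\right),\qquad s_0=\tfrac1g\left(r[k-2]_q-\mu[k-1]_q+q^{k-2}\right),$$ and it has cardinality $\#\mathcal{M}'=\tfrac1g\left(r[k-1]_q-\mu[k]_q\right)$. (3) Moreover, $$\mathbb{L}(\overline{\mathcal{M}})=\left\{\left(us_0+v[k-1]_q,\;ut_0+v[k-1]_q\right) : u,v\in\mathbb{N}\right\}.$$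
   Context: $\mathbb{N}=\{0,1,2,\dots\}$ and $[j]_q:=\frac{q^j-1}{q-1}$ for integers $j\ge0$ (so $[0]_q=0$). $\mathcal{P}$ and $\mathcal{H}$ denote the sets of points ($1$-dimensional subspaces of $\mathbb{F}_q^k$) and hyperplanes ($(k-1)$-dimensional subspaces of $\mathbb{F}_q^k$) of $\operatorname{PG}(k-1,q)$; for $k=2$ hyperplanes coincide with points. A multiset of points is a function $\mathcal{M}\colon\mathcal{P}\to\mathbb{N}$. For a set $S$ of points (a subspace being identified with the set of points it contains) put $\mathcal{M}(S)=\sum_{P\in S}\mathcal{M}(P)$, and put $\#\mathcal{M}=\sum_{P\in\mathcal{P}}\mathcal{M}(P)$. A set of points is a multiset of points with values in $\{0,1\}$. $\chi_S$ is the characteristic function of $S\subseteq\mathcal{P}$ (value $1$ on points of $S$ and $0$ otherwise), and $\chi_V$ is the function with constant value $1$ on $\mathcal{P}$. A two-character multiset is a multiset of points $\mathcal{M}$ such that $\{\mathcal{M}(H):H\in\mathcal{H}\}$ has exactly two elements. Fix a non-degenerate bilinear form on $\mathbb{F}_q^k$. For a point $P$ let $P^\perp$ be the hyperplane perpendicular to $P$; $P\mapsto P^\perp$ is a bijection $\mathcal{P}\to\mathcal{H}$, and for a hyperplane $H$ the point $P$ with $P^\perp=H$ is denoted $H^\perp$. For a set of points $\overline{\mathcal{M}}$, $\mathbb{L}(\overline{\mathcal{M}})\subseteq\mathbb{N}^2$ is the set of all pairs $(s,t)\in\mathbb{N}^2$ with $s\ge t$ for which there exists a multiset of points $\mathcal{M}$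 in $\operatorname{PG}(k-1,q)$ such that for all $H\in\mathcal{H}$: $\mathcal{M}(H)=s$ if $\overline{\mathcal{M}}(H^\perp)=1$, and $\mathcal{M}(H)=t$ if $\overline{\mathcal{M}}(H^\perp)=0$. Such an $\mathcal{M}$ is said to correspond to $(s,t)\in\mathbb{L}(\overline{\mathcal{M}})$. *)

theory Defs
  imports "HOL-Analysis.Cartesian_Space"
begin

text \<open>
  The ambient space is \<open>'a ^ 'n\<close>, with \<open>'a\<close> a finite field of order \<open>q = CARD('a)\<close> and
  \<open>k = CARD('n)\<close>.  Points and hyperplanes of \<open>PG(k-1,q)\<close> are subspaces, that is, sets of vectors;
  only the values of a multiset of points at members of \<open>points\<close> are ever meaningful.
\<close>

definition points :: "('a::{field,finite} ^ 'n::finite) set set" where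
  "points = {P. vec.subspace P \<and> vec.dim P = 1}"

definition hyperplanes :: "('a::{field,finite} ^ 'n::finite) set set" where
  "hyperplanes = {H. vec.subspace H \<and> vec.dim H = CARD('n) - 1}"

text \<open>Makes explicit the identification of a subspace with the set of points it contains.\<close>

definition points_in :: "('a::{field,finite} ^ 'n::finite) set \<Rightarrow> ('a ^ 'n) set set" where
  "points_in U = {P \<in> points. P \<subseteq> U}"

type_synonym ('a, 'n) point_multiset = "('a ^ 'n) set \<Rightarrow> nat"

definition mult_of ::
    "('a::{field,finite}, 'n::finite) point_multiset \<Rightarrow> ('a ^ 'n) set set \<Rightarrow> nat" where
  "mult_of M S = (\<Sum>P\<in>S. M P)"

definition cardinality :: "('a::{field,finite}, 'n::finite) point_multiset \<Rightarrow> nat" where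
  "cardinality M = (\<Sum>P\<in>points. M P)"

definition set_of_points :: "('a::{field,finite}, 'n::finite) point_multiset \<Rightarrow> bool" where
  "set_of_points M \<longleftrightarrow> (\<forall>P\<in>points. M P \<in> {0, 1})"

definition chi :: "('a::{field,finite} ^ 'n::finite) set set \<Rightarrow> ('a, 'n) point_multiset" where
  "chi S P = (if P \<in> S then 1 else 0)"

definition two_character :: "('a::{field,finite}, 'n::finite) point_multiset \<Rightarrow> bool" where
  "two_character M \<longleftrightarrow> card {mult_of M (points_in H) | H. H \<in> hyperplanes} = 2"

text \<open>The division is exact whenever \<open>q \<ge> 2\<close>.\<close>

definition qint :: "nat \<Rightarrow> nat \<Rightarrow> nat" where
  "qint q j = (q ^ j - 1) div (q - 1)"

text \<open>The form is not required to be symmetric or alternating.\<close>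

definition bilinear_form :: "('a::field ^ 'n::finite \<Rightarrow> 'a ^ 'n \<Rightarrow> 'a) \<Rightarrow> bool" where
  "bilinear_form B \<longleftrightarrow>
     (\<forall>x. Vector_Spaces.linear (*s) (*) (\<lambda>y. B x y)) \<and>
     (\<forall>y. Vector_Spaces.linear (*s) (*) (\<lambda>x. B x y))"

definition nondegenerate :: "('a::field ^ 'n::finite \<Rightarrow> 'a ^ 'n \<Rightarrow> 'a) \<Rightarrow> bool" where
  "nondegenerate B \<longleftrightarrow>
     (\<forall>x. (\<forall>y. B x y = 0) \<longrightarrow> x = 0) \<and> (\<forall>y. (\<forall>x. B x y = 0) \<longrightarrow> y = 0)"

text \<open>
  For a form that is not reflexive this is the right perpendicular space; the left one is
  obtained by exchanging the arguments of \<open>B\<close>.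
\<close>

definition perp ::
    "('a::{field,finite} ^ 'n::finite \<Rightarrow> 'a ^ 'n \<Rightarrow> 'a) \<Rightarrow> ('a ^ 'n) set \<Rightarrow> ('a ^ 'n) set" where
  "perp B P = {y. \<forall>x\<in>P. B x y = 0}"

text \<open>
  The point \<open>H\<^sup>\<bottom>\<close> of a hyperplane \<open>H\<close>: the inverse of the bijection \<open>P \<mapsto> P\<^sup>\<bottom>\<close> from points to
  hyperplanes, which for a form that is not reflexive differs from \<open>perp B H\<close>.
\<close>

definition perp_point ::
    "('a::{field,finite} ^ 'n::finite \<Rightarrow> 'a ^ 'n \<Rightarrow> 'a) \<Rightarrow> ('a ^ 'n) set \<Rightarrow> ('a ^ 'n) set" where
  "perp_point B H = (THE P. P \<in> points \<and> perp B P = H)"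

definition corresponds ::
    "('a::{field,finite} ^ 'n::finite \<Rightarrow> 'a ^ 'n \<Rightarrow> 'a) \<Rightarrow> ('a, 'n) point_multiset
      \<Rightarrow> ('a, 'n) point_multiset \<Rightarrow> nat \<times> nat \<Rightarrow> bool" where
  "corresponds B Mbar M = (\<lambda>(s, t).
     \<forall>H\<in>hyperplanes.
       (Mbar (perp_point B H) = 1 \<longrightarrow> mult_of M (points_in H) = s) \<and>
       (Mbar (perp_point B H) = 0 \<longrightarrow> mult_of M (points_in H) = t))"

definition LL ::
    "('a::{field,finite} ^ 'n::finite \<Rightarrow> 'a ^ 'n \<Rightarrow> 'a) \<Rightarrow> ('a, 'n) point_multiset
      \<Rightarrow> (nat \<times> nat) set" where
  "LL B Mbar = {(s, t). s \<ge> t \<and> (\<exists>M. corresponds B Mbar M (s, t))}"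

end

theory Submission
  imports Defs
begin

text \<open>
  Write \<open>B'\<close> for the form \<open>B\<close> with its arguments exchanged and, for a weight \<open>w\<close> on the points, let
  \<open>D\<^sub>B w\<close> be the weight that gives a point \<open>P\<close> the total weight of the hyperplane \<open>P\<^sup>\<bottom>\<close>.  Since
  \<open>P \<subseteq> Q\<^sup>\<bottom>\<close> for \<open>B\<close> is the same as \<open>Q \<subseteq> P\<^sup>\<bottom>\<close> for \<open>B'\<close>, summing over the hyperplanes through a
  point is also an operator of this kind, namely \<open>D\<close> for \<open>B'\<close>.  In these terms \<open>M\<close> is \<open>D\<^bsub>B'\<^esub> Mbar\<close>,
  and \<open>N\<close> corresponds to \<open>(s, t)\<close> with \<open>s \<ge> t\<close> exactly if \<open>D\<^sub>B N = t + (s - t) Mbar\<close>.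

  Everything rests on one double count.  Points and hyperplanes form a symmetric design: a
  hyperplane has \<open>[k-1]\<^sub>q\<close> points and two of them share \<open>[k-2]\<^sub>q\<close> points, where
  \<open>[k-1]\<^sub>q = [k-2]\<^sub>q + q\<^bsup>k-2\<^esup>\<close>.  Hence
  \<open>D\<^sub>B (D\<^bsub>B'\<^esub> w) = q\<^bsup>k-2\<^esup> w + [k-2]\<^sub>q #w\<close> for every weight \<open>w\<close> (lemma \<open>dual_mult_dual_mult\<close>).

  For \<open>w = Mbar\<close> this computes the two hyperplane values of \<open>M\<close>.  Subtracting the constant \<open>\<mu>\<close>
  and dividing by \<open>g\<close> leaves a multiset \<open>M'\<close> with two hyperplane values as well; the difference of
  the values of \<open>M\<close> is \<open>q\<^bsup>k-2\<^esup>\<close>, and it is \<open>g\<close> times the difference of those of \<open>M'\<close>.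

  With the roles of \<open>B\<close> and \<open>B'\<close> exchanged, the same formula recovers a multiset from its hyperplane
  values.  If \<open>N\<close> corresponds to \<open>(s, t)\<close>, then \<open>q\<^bsup>k-2\<^esup> N = (s - t) M + const = (s - t) g M' + const\<close>.
  As \<open>M'\<close> vanishes at some point, \<open>q\<^bsup>k-2\<^esup>\<close> divides \<open>(s - t) g M'(P)\<close> for each \<open>P\<close>, and as the values
  of \<open>M'\<close> have greatest common divisor \<open>1\<close>, it divides \<open>(s - t) g\<close>.  So \<open>N = u M' + v\<close> with natural
  numbers \<open>u\<close> and \<open>v\<close> (lemma \<open>corresponds_imp_affine\<close>), which is the description of
  \<open>LL B Mbar\<close>.
\<close>

section \<open>Counting the points of a subspace\<close>

lemma card_field_gt_1: "CARD('a::{field,finite}) > 1"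
proof -
  have "card {0, 1 :: 'a} \<le> CARD('a)"
    by (rule card_mono) auto
  then show ?thesis by simp
qed

text \<open>The geometric sum is the form of \<open>qint\<close> without the truncating operations of \<open>nat\<close>.\<close>
lemma power_eq_qint:
  assumes "q > 1"
  shows "q ^ j - 1 = (q - 1) * (\<Sum>i<j. q ^ i)" and "qint q j = (\<Sum>i<j. q ^ i)"
proof -
  have "q ^ j = (q - 1) * (\<Sum>i<j. q ^ i) + 1"
  proof (induction j)
    case (Suc j)
    have "q ^ Suc j = (q - 1) * q ^ j + q ^ j"
      using assms by (cases q) auto
    with Suc show ?case by (simp add: algebra_simps)
  qed simp
  then show *: "q ^ j - 1 = (q - 1) * (\<Sum>i<j. q ^ i)"
    by simp
  show "qint q j = (\<Sum>i<j. q ^ i)"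
    using assms unfolding qint_def * by simp
qed

lemma qint_Suc: "q > 1 \<Longrightarrow> qint q (Suc j) = qint q j + q ^ j"
  by (simp add: power_eq_qint)

lemma card_span_insert:
  fixes a :: "'a::{field,finite} ^ 'n::finite"
  assumes "a \<notin> vec.span S"
  shows "card (vec.span (insert a S)) = CARD('a) * card (vec.span S)"
proof -
  have "bij_betw (\<lambda>(c, y). c *s a + y) (UNIV \<times> vec.span S) (vec.span (insert a S))"
  proof (rule bij_betwI')
    fix p r :: "'a \<times> ('a ^ 'n)"
    assume "p \<in> UNIV \<times> vec.span S" "r \<in> UNIV \<times> vec.span S"
    then obtain c y d z where p: "p = (c, y)" "y \<in> vec.span S" and r: "r = (d, z)" "z \<in> vec.span S"
      by auto
    have "c = d \<and> y = z" if eq: "c *s a + y = d *s a + z"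
    proof -
      have "(c - d) *s a = z - y"
        using eq by (simp add: vector_sub_rdistrib algebra_simps)
      then have "(c - d) *s a \<in> vec.span S"
        using p r by (simp add: vec.span_diff)
      then have "inverse (c - d) *s ((c - d) *s a) \<in> vec.span S"
        by (rule vec.span_scale)
      then have "c = d"
        using assms by (cases "c = d") (auto simp: vector_smult_assoc)
      then show ?thesis using eq by simp
    qed
    then show "((\<lambda>(c, y). c *s a + y) p = (\<lambda>(c, y). c *s a + y) r) = (p = r)"
      using p r by auto
  next
    fix p :: "'a \<times> ('a ^ 'n)"
    assume "p \<in> UNIV \<times> vec.span S"
    then show "(\<lambda>(c, y). c *s a + y) p \<in> vec.span (insert a S)"
      by (auto simp: vec.span_breakdown_eq intro: exI[of _ "fst p"])
  next
    fix x assume "x \<in> vec.span (insert a S)"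
    then obtain c where "x - c *s a \<in> vec.span S"
      by (auto simp: vec.span_breakdown_eq)
    then show "\<exists>p\<in>UNIV \<times> vec.span S. x = (\<lambda>(c, y). c *s a + y) p"
      by (intro bexI[of _ "(c, x - c *s a)"]) auto
  qed
  then show ?thesis
    by (simp add: bij_betw_same_card[symmetric] card_cartesian_product)
qed

lemma card_subspace:
  fixes U :: "('a::{field,finite} ^ 'n::finite) set"
  assumes "vec.subspace U"
  shows "card U = CARD('a) ^ vec.dim U"
proof -
  obtain A where A: "A \<subseteq> U" "vec.independent A" "U \<subseteq> vec.span A" "card A = vec.dim U"
    using vec.basis_exists by blast
  have "card (vec.span A) = CARD('a) ^ card A"
    using finite[of A] A(2)
  proof (induction A)
    case (insert a A)
    then show ?case
      by (auto simp: vec.independent_insert card_span_insert)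
  qed simp
  moreover have "vec.span A = U"
    using A assms vec.span_minimal by blast
  ultimately show ?thesis using A by simp
qed

lemma point_eq_span:
  assumes "P \<in> points" "x \<in> P" "x \<noteq> 0"
  shows "P = vec.span {x}"
proof -
  have "vec.span {x} \<subseteq> P"
    using assms by (intro vec.span_minimal) (auto simp: points_def)
  then show ?thesis
    using vec.subspace_dim_equal[of "vec.span {x}" P] assms by (auto simp: points_def)
qed

lemma span_in_points: "x \<noteq> 0 \<Longrightarrow> vec.span {x} \<in> points"
  by (simp add: points_def)

lemma point_generator:
  assumes "P \<in> points"
  obtains x where "x \<noteq> 0" "P = vec.span {x}"
proof -
  have "\<not> P \<subseteq> {0}"
    using assms vec.dim_eq_0[of P] by (auto simp: points_def)
  then show ?thesis
    using that point_eq_span[OF assms] by blast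
qed

text \<open>The nonzero vectors of \<open>U\<close> are partitioned by its points into classes of size \<open>q - 1\<close>.\<close>
lemma card_points_in:
  fixes U :: "('a::{field,finite} ^ 'n::finite) set"
  assumes "vec.subspace U"
  shows "card (points_in U) = qint CARD('a) (vec.dim U)"
proof -
  have "U - {0} = (\<Union>P\<in>points_in U. P - {0})"
  proof (intro equalityI subsetI)
    fix x assume x: "x \<in> U - {0}"
    then have "vec.span {x} \<in> points_in U"
      using assms by (auto simp: points_in_def span_in_points vec.span_minimal)
    then show "x \<in> (\<Union>P\<in>points_in U. P - {0})"
      using x vec.span_base[of x "{x}"] by blast
  qed (auto simp: points_in_def)
  moreover have "card (\<Union>P\<in>points_in U. P - {0}) = (\<Sum>P\<in>points_in U. card (P - {0}))"
  proof (rule card_UN_disjoint)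
    show "\<forall>P\<in>points_in U. \<forall>Q\<in>points_in U. P \<noteq> Q \<longrightarrow> (P - {0}) \<inter> (Q - {0}) = {}"
      using point_eq_span unfolding points_in_def by blast
  qed auto
  moreover have "card (P - {0}) = CARD('a) - 1" if "P \<in> points_in U" for P
    using that card_subspace[of P] vec.subspace_0[of P]
    by (simp add: points_in_def points_def card_Diff_singleton)
  ultimately have "card (U - {0}) = (CARD('a) - 1) * card (points_in U)"
    by simp
  moreover have "card (U - {0}) = CARD('a) ^ vec.dim U - 1"
    using assms by (simp add: card_Diff_singleton vec.subspace_0 card_subspace)
  ultimately have "(CARD('a) - 1) * card (points_in U) = (CARD('a) - 1) * qint CARD('a) (vec.dim U)"
    using power_eq_qint[OF card_field_gt_1[where 'a='a]] by metis
  then show ?thesis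
    using card_field_gt_1[where 'a='a] by simp
qed

section \<open>Perpendicular hyperplanes\<close>

text \<open>
  For \<open>U\<close> itself a hyperplane and \<open>f\<close> a functional that does not vanish on it, this gives the
  dimension of the intersection of two hyperplanes.
\<close>
lemma dim_kernel_in_subspace:
  fixes f :: "'a::field ^ 'n::finite \<Rightarrow> 'a"
  assumes f: "Vector_Spaces.linear (*s) (*) f" and U: "vec.subspace U" and a: "a \<in> U" "f a \<noteq> 0"
  shows "vec.dim U = Suc (vec.dim {y \<in> U. f y = 0})"
proof -
  interpret f: Vector_Spaces.linear "(*s)" "(*)" f by (rule f)
  let ?K = "{y \<in> U. f y = 0}"
  have K: "vec.subspace ?K"
    using U by (auto simp: vec.subspace_def f.add f.scale f.zero)
  have "U \<subseteq> vec.span (insert a ?K)"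
  proof
    fix y assume "y \<in> U"
    then have "y - (f y / f a) *s a \<in> ?K"
      using U a by (auto simp: vec.subspace_diff vec.subspace_scale f.diff f.scale)
    then show "y \<in> vec.span (insert a ?K)"
      unfolding vec.span_breakdown_eq by (meson vec.span_base)
  qed
  moreover have "vec.span (insert a ?K) \<subseteq> U"
    using U a by (intro vec.span_minimal) auto
  ultimately have "vec.dim U = vec.dim (insert a ?K)"
    by (metis vec.dim_span subset_antisym)
  also have "\<dots> = Suc (vec.dim ?K)"
    using a K by (simp add: vec.dim_insert vec.span_eq_iff[THEN iffD2])
  finally show ?thesis .
qed

lemma bilinear_flip: "bilinear_form B \<Longrightarrow> bilinear_form (\<lambda>x y. B y x)"
  by (simp add: bilinear_form_def)

lemma nondegenerate_flip: "nondegenerate B \<Longrightarrow> nondegenerate (\<lambda>x y. B y x)"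
  by (auto simp: nondegenerate_def)

lemma bilinear_form_linear:
  assumes "bilinear_form B"
  shows "Vector_Spaces.linear (*s) (*) (B x)" "Vector_Spaces.linear (*s) (*) (\<lambda>x. B x y)"
  using assms by (auto simp: bilinear_form_def)

lemma linear_vec_rules:
  assumes "Vector_Spaces.linear (*s) (*) (f :: 'a::field ^ 'n::finite \<Rightarrow> 'a)"
  shows "f (x + y) = f x + f y" "f (c *s x) = c * f x" "f 0 = 0" "f (x - y) = f x - f y"
proof -
  interpret f: Vector_Spaces.linear "(*s)" "(*)" f by (rule assms)
  show "f (x + y) = f x + f y" "f (c *s x) = c * f x" "f 0 = 0" "f (x - y) = f x - f y"
    by (simp_all add: f.add f.scale f.zero f.diff)
qed

lemmas form_right = linear_vec_rules[OF bilinear_form_linear(1)]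
lemmas form_left = linear_vec_rules[OF bilinear_form_linear(2)]

lemma perp_span:
  assumes "bilinear_form B"
  shows "perp B (vec.span {x}) = {y. B x y = 0}"
proof -
  have "x \<in> vec.span {x}" by (simp add: vec.span_base)
  then show ?thesis
    by (auto simp: perp_def vec.span_singleton form_left[OF assms])
qed

lemma subspace_perp:
  assumes "bilinear_form B"
  shows "vec.subspace (perp B P)"
  by (auto simp: perp_def vec.subspace_def form_right[OF assms])

text \<open>
  A functional that vanishes on the kernel of another one is a multiple of it, and by nondegeneracy
  the multiple passes to the vectors that represent the functionals.
\<close>
lemma perp_antimono_points:
  assumes B: "bilinear_form B" "nondegenerate B"
    and P: "P \<in> points" and Q: "Q \<in> points" and sub: "perp B P \<subseteq> perp B Q"
  shows "P = Q"
proof -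
  obtain x where x: "x \<noteq> 0" "P = vec.span {x}" using point_generator[OF P] .
  obtain y where y: "y \<noteq> 0" "Q = vec.span {y}" using point_generator[OF Q] .
  have ker: "B y z = 0" if "B x z = 0" for z
    using sub that by (auto simp: x y perp_span[OF B(1)])
  obtain a where a: "B x a \<noteq> 0"
    using B(2) x(1) by (auto simp: nondegenerate_def)
  define c where "c = B y a / B x a"
  have "B (y - c *s x) z = 0" for z
  proof -
    have "B x (z - (B x z / B x a) *s a) = 0"
      using a by (simp add: form_right[OF B(1)])
    from ker[OF this] have "B y z = c * B x z"
      by (simp add: form_right[OF B(1)] c_def)
    then show ?thesis
      by (simp add: form_left[OF B(1)])
  qed
  then have "y - c *s x = 0"
    using B(2) unfolding nondegenerate_def by blast
  then have "y = c *s x" by simp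
  then have "y \<in> P"
    by (auto simp: x vec.span_singleton)
  then show ?thesis
    using point_eq_span[OF P _ y(1)] y(2) by simp
qed

lemma dim_perp:
  fixes B :: "'a::{field,finite} ^ 'n::finite \<Rightarrow> 'a ^ 'n \<Rightarrow> 'a"
  assumes B: "bilinear_form B" "nondegenerate B" and P: "P \<in> points"
  shows "Suc (vec.dim (perp B P)) = CARD('n)"
proof -
  obtain x where x: "x \<noteq> 0" "P = vec.span {x}" using point_generator[OF P] .
  obtain a where "B x a \<noteq> 0"
    using B(2) x(1) by (auto simp: nondegenerate_def)
  from dim_kernel_in_subspace[OF bilinear_form_linear(1)[OF B(1)] vec.subspace_UNIV UNIV_I this]
  show ?thesis
    by (simp add: x perp_span[OF B(1)] vec_dim_card del: vec.dim_UNIV)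
qed

lemma dim_perp_Int:
  fixes B :: "'a::{field,finite} ^ 'n::finite \<Rightarrow> 'a ^ 'n \<Rightarrow> 'a"
  assumes B: "bilinear_form B" "nondegenerate B" and P: "P \<in> points" and Q: "Q \<in> points"
    and "P \<noteq> Q"
  shows "Suc (Suc (vec.dim (perp B P \<inter> perp B Q))) = CARD('n)"
proof -
  obtain y where y: "y \<noteq> 0" "Q = vec.span {y}" using point_generator[OF Q] .
  obtain b where b: "b \<in> perp B P" "B y b \<noteq> 0"
    using perp_antimono_points[OF B P Q] \<open>P \<noteq> Q\<close> by (auto simp: y perp_span[OF B(1)])
  have "perp B P \<inter> perp B Q = {z \<in> perp B P. B y z = 0}"
    by (auto simp: y perp_span[OF B(1)])
  with dim_kernel_in_subspace[OF bilinear_form_linear(1)[OF B(1)] subspace_perp[OF B(1)] b]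
  show ?thesis
    using dim_perp[OF B P] by simp
qed

text \<open>
  The pigeonhole principle replaces the dual basis here: there are \<open>q\<^bsup>k\<^esup>\<close> vectors but only
  \<open>q\<^bsup>k-1\<^esup>\<close> tuples of values on a basis of \<open>H\<close>, so two functionals \<open>B u\<close> and \<open>B v\<close> agree on \<open>H\<close>.
\<close>
lemma hyperplane_subset_perp:
  fixes B :: "'a::{field,finite} ^ 'n::finite \<Rightarrow> 'a ^ 'n \<Rightarrow> 'a"
  assumes B: "bilinear_form B" and H: "H \<in> hyperplanes"
  obtains P where "P \<in> points" "H \<subseteq> perp B P"
proof -
  obtain A where A: "A \<subseteq> H" "vec.independent A" "H \<subseteq> vec.span A" "card A = vec.dim H"
    using vec.basis_exists by blast
  let ?T = "\<lambda>x. restrict (B x) A"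
  have "card (A \<rightarrow>\<^sub>E (UNIV :: 'a set)) < CARD('a ^ 'n)"
    using H A card_field_gt_1[where 'a='a] zero_less_card_finite[where 'a='n]
    by (simp add: card_funcsetE hyperplanes_def)
  then have "\<not> inj ?T"
    using card_inj_on_le[of ?T UNIV "A \<rightarrow>\<^sub>E (UNIV :: 'a set)"]
    by (auto simp: finite_PiE image_subset_iff simp del: CARD_vec)
  then obtain u v where uv: "u \<noteq> v" "?T u = ?T v"
    by (auto simp: inj_def)
  define x where "x = u - v"
  have "B x y = 0" if "y \<in> A" for y
    using fun_cong[OF uv(2), of y] that by (simp add: x_def form_left[OF B])
  then have "A \<subseteq> perp B (vec.span {x})"
    by (auto simp: perp_span[OF B])
  then have "H \<subseteq> perp B (vec.span {x})"
    using A(3) vec.span_minimal[OF _ subspace_perp[OF B]] by blast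
  moreover have "vec.span {x} \<in> points"
    using uv by (simp add: span_in_points x_def)
  ultimately show ?thesis using that by blast
qed

lemma bij_betw_perp:
  fixes B :: "'a::{field,finite} ^ 'n::finite \<Rightarrow> 'a ^ 'n \<Rightarrow> 'a"
  assumes B: "bilinear_form B" "nondegenerate B"
  shows "bij_betw (perp B) points hyperplanes"
proof (rule bij_betwI')
  show "(perp B P = perp B Q) = (P = Q)" if "P \<in> points" "Q \<in> points" for P Q
    using perp_antimono_points[OF B that] by auto
  show "perp B P \<in> hyperplanes" if "P \<in> points" for P
    using dim_perp[OF B that] by (auto simp: hyperplanes_def subspace_perp[OF B(1)])
  show "\<exists>P\<in>points. H = perp B P" if H: "H \<in> hyperplanes" for H
  proof -
    obtain P where P: "P \<in> points" "H \<subseteq> perp B P"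
      using hyperplane_subset_perp[OF B(1) H] .
    then have "H = perp B P"
      using H dim_perp[OF B P(1)]
      by (intro vec.subspace_dim_equal) (auto simp: hyperplanes_def subspace_perp[OF B(1)])
    with P show ?thesis by blast
  qed
qed

lemma perp_point_perp:
  assumes B: "bilinear_form B" "nondegenerate B" and P: "P \<in> points"
  shows "perp_point B (perp B P) = P"
  unfolding perp_point_def
  using perp_antimono_points[OF B _ P] P by (intro the_equality) auto

text \<open>
  This turns each count of points in hyperplanes into one of hyperplanes through points.
\<close>
lemma subset_perp_flip: "P \<subseteq> perp B Q \<longleftrightarrow> Q \<subseteq> perp (\<lambda>x y. B y x) P"
  by (auto simp: perp_def)

lemma card_points_in_perp:
  fixes B :: "'a::{field,finite} ^ 'n::finite \<Rightarrow> 'a ^ 'n \<Rightarrow> 'a"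
  assumes B: "bilinear_form B" "nondegenerate B" and P: "P \<in> points"
  shows "card {Q \<in> points. Q \<subseteq> perp B P} = qint CARD('a) (CARD('n) - 1)"
  using card_points_in[OF subspace_perp[OF B(1)], of P] dim_perp[OF B P, symmetric]
  by (simp add: points_in_def)

lemma card_points_in_perp_Int:
  fixes B :: "'a::{field,finite} ^ 'n::finite \<Rightarrow> 'a ^ 'n \<Rightarrow> 'a"
  assumes B: "bilinear_form B" "nondegenerate B" and P: "P \<in> points" and P': "P' \<in> points"
    and "P \<noteq> P'"
  shows "card {Q \<in> points. Q \<subseteq> perp B P \<and> Q \<subseteq> perp B P'} = qint CARD('a) (CARD('n) - 2)"
  using card_points_in[OF vec.subspace_inter[OF subspace_perp subspace_perp, OF B(1) B(1)], of P P']
    dim_perp_Int[OF B P P' \<open>P \<noteq> P'\<close>, symmetric]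
  by (simp add: points_in_def)

lemma qint_pred_dim:
  assumes "CARD('n::finite) \<ge> 2"
  shows "qint CARD('a::{field,finite}) (CARD('n) - 1)
    = qint CARD('a) (CARD('n) - 2) + CARD('a) ^ (CARD('n) - 2)"
proof -
  have "CARD('n) - 1 = Suc (CARD('n) - 2)"
    using assms by simp
  then show ?thesis
    by (simp add: qint_Suc[OF card_field_gt_1[where 'a='a]])
qed

section \<open>The incidence operator and its inversion\<close>

text \<open>
  Double counting in a design: after exchanging the sums, \<open>w x'\<close> is counted once for each block
  through \<open>x\<close> and \<open>x'\<close>, that is, \<open>b\<close> times, and another \<open>c\<close> times if \<open>x' = x\<close>.
\<close>
lemma sum_over_common_blocks:
  fixes w :: "'x \<Rightarrow> nat"
  assumes "finite X" "finite Y" "x \<in> X"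
    and deg: "card {y \<in> Y. R x y} = b + c"
    and codeg: "\<And>x'. x' \<in> X \<Longrightarrow> x' \<noteq> x \<Longrightarrow> card {y \<in> Y. R x y \<and> R x' y} = b"
  shows "(\<Sum>y | y \<in> Y \<and> R x y. \<Sum>x' | x' \<in> X \<and> R x' y. w x') = c * w x + b * sum w X"
proof -
  have "(\<Sum>y | y \<in> Y \<and> R x y. \<Sum>x' | x' \<in> X \<and> R x' y. w x')
      = (\<Sum>x'\<in>X. \<Sum>y | y \<in> {y \<in> Y. R x y} \<and> R x' y. w x')"
    using assms(1,2) sum.swap_restrict[of "{y \<in> Y. R x y}" X "\<lambda>y x'. w x'" "\<lambda>y x'. R x' y"]
    by simp
  also have "\<dots> = (\<Sum>x'\<in>X. card {y \<in> Y. R x y \<and> R x' y} * w x')"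
    by simp
  also have "\<dots> = (b + c) * w x + (\<Sum>x'\<in>X - {x}. b * w x')"
    using assms by (subst sum.remove[of X x]) auto
  also have "\<dots> = c * w x + b * sum w X"
    using assms(1,3) by (simp add: sum.remove[of X x w] sum_distrib_left algebra_simps)
  finally show ?thesis .
qed

text \<open>
  The multiset of hyperplane values, moved to the points along \<open>P \<mapsto> P\<^sup>\<bottom>\<close>, so that source and target
  are the same kind of object and the operators for \<open>B\<close> and for the flipped form can be composed.
\<close>
definition dual_mult ::
    "('a::{field,finite} ^ 'n::finite \<Rightarrow> 'a ^ 'n \<Rightarrow> 'a) \<Rightarrow> ('a, 'n) point_multiset
      \<Rightarrow> ('a, 'n) point_multiset" where
  "dual_mult B w P = mult_of w (points_in (perp B P))"

lemma dual_mult_sum: "dual_mult B w P = (\<Sum>Q | Q \<in> points \<and> Q \<subseteq> perp B P. w Q)"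
  by (simp add: dual_mult_def mult_of_def points_in_def)

lemma dual_mult_cong:
  "(\<And>P. P \<in> points \<Longrightarrow> w P = w' P) \<Longrightarrow> dual_mult B w P = dual_mult B w' P"
  by (simp add: dual_mult_sum)

lemma dual_mult_affine:
  fixes B :: "'a::{field,finite} ^ 'n::finite \<Rightarrow> 'a ^ 'n \<Rightarrow> 'a"
  assumes "bilinear_form B" "nondegenerate B" "P \<in> points"
  shows "dual_mult B (\<lambda>Q. a * w Q + b) P = a * dual_mult B w P + b * qint CARD('a) (CARD('n) - 1)"
  by (simp add: dual_mult_sum sum.distrib card_points_in_perp[OF assms] sum_distrib_left)

text \<open>
  Up to a factor and an additive constant, the operator for the flipped form inverts the one for \<open>B\<close>.  The factor of \<open>w P\<close>
  is the difference of the numbers of points on one hyperplane and on two.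
\<close>
lemma dual_mult_dual_mult:
  fixes B :: "'a::{field,finite} ^ 'n::finite \<Rightarrow> 'a ^ 'n \<Rightarrow> 'a" and w :: "('a, 'n) point_multiset"
  assumes B: "bilinear_form B" "nondegenerate B" and n: "CARD('n) \<ge> 2" and P: "P \<in> points"
  shows "dual_mult B (dual_mult (\<lambda>x y. B y x) w) P
    = CARD('a) ^ (CARD('n) - 2) * w P + qint CARD('a) (CARD('n) - 2) * cardinality w"
proof -
  have "card {Q \<in> points. Q \<subseteq> perp B P}
      = qint CARD('a) (CARD('n) - 2) + CARD('a) ^ (CARD('n) - 2)"
    using card_points_in_perp[OF B P] qint_pred_dim[OF n, where 'a='a] by simp
  moreover have "card {Q \<in> points. Q \<subseteq> perp B P \<and> Q \<subseteq> perp B P'} = qint CARD('a) (CARD('n) - 2)"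
    if "P' \<in> points" "P' \<noteq> P" for P'
    using card_points_in_perp_Int[OF B P that(1)] that(2) by blast
  ultimately have "(\<Sum>Q | Q \<in> points \<and> Q \<subseteq> perp B P. \<Sum>P' | P' \<in> points \<and> Q \<subseteq> perp B P'. w P')
    = CARD('a) ^ (CARD('n) - 2) * w P + qint CARD('a) (CARD('n) - 2) * sum w points"
    using P by (intro sum_over_common_blocks) simp_all
  then show ?thesis
    by (simp add: dual_mult_sum cardinality_def subset_perp_flip[of _ B])
qed

text \<open>Each point lies on as many hyperplanes as a hyperplane has points.\<close>
lemma cardinality_dual_mult:
  fixes B :: "'a::{field,finite} ^ 'n::finite \<Rightarrow> 'a ^ 'n \<Rightarrow> 'a" and w :: "('a, 'n) point_multiset"
  assumes B: "bilinear_form B" "nondegenerate B"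
  shows "cardinality (dual_mult B w) = cardinality w * qint CARD('a) (CARD('n) - 1)"
proof -
  have "cardinality (dual_mult B w) = (\<Sum>Q\<in>points. \<Sum>P | P \<in> points \<and> Q \<subseteq> perp B P. w Q)"
    unfolding cardinality_def dual_mult_sum by (rule sum.swap_restrict) auto
  also have "\<dots> = (\<Sum>Q\<in>points. qint CARD('a) (CARD('n) - 1) * w Q)"
    by (simp add: subset_perp_flip[of _ B]
        card_points_in_perp[OF bilinear_flip[OF B(1)] nondegenerate_flip[OF B(2)]])
  finally show ?thesis
    by (simp add: cardinality_def sum_distrib_right mult.commute)
qed

lemma card_points: "card (points :: ('a::{field,finite} ^ 'n::finite) set set) = qint CARD('a) CARD('n)"
  using card_points_in[OF vec.subspace_UNIV, where 'a='a and 'n='n]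
  by (simp add: points_in_def vec_dim_card del: vec.dim_UNIV)

section \<open>Corresponding multisets\<close>

lemma sum_hyperplanes_eq_dual_mult:
  fixes B :: "'a::{field,finite} ^ 'n::finite \<Rightarrow> 'a ^ 'n \<Rightarrow> 'a"
  assumes B: "bilinear_form B" "nondegenerate B" and P: "P \<in> points"
  shows "(\<Sum>H\<in>hyperplanes. w (perp_point B H) * chi (points_in H) P)
    = dual_mult (\<lambda>x y. B y x) w P"
proof -
  have "(\<Sum>H\<in>hyperplanes. w (perp_point B H) * chi (points_in H) P)
      = (\<Sum>Q\<in>points. w (perp_point B (perp B Q)) * chi (points_in (perp B Q)) P)"
    by (rule sum.reindex_bij_betw[OF bij_betw_perp[OF B], symmetric])
  also have "\<dots> = (\<Sum>Q\<in>points. if P \<subseteq> perp B Q then w Q else 0)"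
    using P by (intro sum.cong) (auto simp: perp_point_perp[OF B] chi_def points_in_def)
  also have "\<dots> = dual_mult (\<lambda>x y. B y x) w P"
    by (simp add: dual_mult_sum subset_perp_flip[of P] sum.inter_filter)
  finally show ?thesis .
qed

lemma ball_hyperplanes_iff:
  assumes B: "bilinear_form B" "nondegenerate B"
  shows "(\<forall>H\<in>hyperplanes. \<Phi> H) \<longleftrightarrow> (\<forall>P\<in>points. \<Phi> (perp B P))"
  using bij_betw_imp_surj_on[OF bij_betw_perp[OF B]] by (metis (no_types, lifting) imageE imageI)

lemma corresponds_iff_dual_mult:
  assumes B: "bilinear_form B" "nondegenerate B" and w: "set_of_points w"
  shows "corresponds B w N (s, t) \<longleftrightarrow>
    (\<forall>P\<in>points. dual_mult B N P = (if w P = 1 then s else t))"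
  using w unfolding corresponds_def case_prod_conv ball_hyperplanes_iff[OF B]
  by (auto simp: perp_point_perp[OF B] dual_mult_def set_of_points_def)

lemma two_character_dual_mult:
  assumes B: "bilinear_form B" "nondegenerate B"
  shows "two_character N \<longleftrightarrow> card (dual_mult B N ` points) = 2"
proof -
  have "{mult_of N (points_in H) |H. H \<in> hyperplanes} = dual_mult B N ` points"
    unfolding bij_betw_imp_surj_on[OF bij_betw_perp[OF B], symmetric] dual_mult_def by blast
  then show ?thesis
    by (simp add: two_character_def)
qed

lemma corresponds_two_character:
  assumes B: "bilinear_form B" "nondegenerate B" and w: "set_of_points w"
    and "P1 \<in> points" "w P1 = 1" "P0 \<in> points" "w P0 = 0"
    and N: "corresponds B w N (s, t)" and "s \<noteq> t"
  shows "two_character N"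
proof -
  have "dual_mult B N ` points = {s, t}"
    using N assms(4-7) by (force simp: corresponds_iff_dual_mult[OF B w] image_iff)
  then show ?thesis
    using \<open>s \<noteq> t\<close> by (simp add: two_character_dual_mult[OF B])
qed

text \<open>
  A multiset is recovered from its hyperplane values up to the factor \<open>q\<^bsup>k-2\<^esup>\<close> and an
  additive constant.  Comparing with the
  zero \<open>P0\<close> of \<open>M'\<close> removes all constants, and coprimality of the values of \<open>M'\<close> makes the
  quotient \<open>u = (s - t) g / q\<^bsup>k-2\<^esup>\<close> integral; \<open>v\<close> is the value of \<open>N\<close> at \<open>P0\<close>.
\<close>
lemma corresponds_imp_affine:
  fixes B :: "'a::{field,finite} ^ 'n::finite \<Rightarrow> 'a ^ 'n \<Rightarrow> 'a" and w M' N :: "('a, 'n) point_multiset"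
  assumes B: "bilinear_form B" "nondegenerate B" and n: "CARD('n) \<ge> 2" and w: "set_of_points w"
    and M': "\<And>P. P \<in> points \<Longrightarrow> dual_mult (\<lambda>x y. B y x) w P = g * M' P + \<mu>"
    and P0: "P0 \<in> points" "M' P0 = 0" and Gcd: "Gcd (M' ` points) = 1"
    and N: "corresponds B w N (s, t)" and "s \<ge> t"
  obtains u v where "\<And>P. P \<in> points \<Longrightarrow> N P = u * M' P + v"
proof -
  define c where "c = CARD('a) ^ (CARD('n) - 2)"
  have c: "c > 0" by (simp add: c_def)
  have inv: "c * N P + qint CARD('a) (CARD('n) - 2) * cardinality N
      = (s - t) * (g * M' P + \<mu>) + t * qint CARD('a) (CARD('n) - 1)" if P: "P \<in> points" for P
  proof -
    have "dual_mult (\<lambda>x y. B y x) (dual_mult B N) P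
      = dual_mult (\<lambda>x y. B y x) (\<lambda>P. (s - t) * w P + t) P"
      using N w \<open>s \<ge> t\<close>
      by (intro dual_mult_cong) (auto simp: corresponds_iff_dual_mult[OF B w] set_of_points_def)
    then show ?thesis
      using dual_mult_dual_mult[OF bilinear_flip[OF B(1)] nondegenerate_flip[OF B(2)] n P, of N]
      by (simp add: dual_mult_affine[OF bilinear_flip[OF B(1)] nondegenerate_flip[OF B(2)] P]
          M'[OF P] c_def)
  qed
  have scaled: "c * N P = (s - t) * g * M' P + c * N P0" if "P \<in> points" for P
    using inv[OF that] inv[OF P0(1)] by (simp add: P0(2) algebra_simps)
  have "c dvd (s - t) * g * M' P" if "P \<in> points" for P
    using scaled[OF that] by (metis dvd_add_left_iff dvd_triv_left)
  then have "c dvd Gcd ((*) ((s - t) * g) ` (M' ` points))"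
    by (intro Gcd_greatest) auto
  then have "c dvd (s - t) * g"
    by (simp only: Gcd_mult Gcd) simp
  then obtain u where u: "(s - t) * g = c * u" ..
  have "N P = u * M' P + N P0" if "P \<in> points" for P
  proof -
    have "c * N P = c * (u * M' P + N P0)"
      unfolding scaled[OF that] u by (simp add: algebra_simps)
    then show ?thesis using c by simp
  qed
  then show ?thesis using that by blast
qed

section \<open>All corresponding pairs\<close>

theorem theorem5p11:
  fixes B :: "'a::{field,finite} ^ 'n::finite \<Rightarrow> 'a ^ 'n \<Rightarrow> 'a"
    and Mbar M :: "('a, 'n) point_multiset"
    and q k r \<mu> g :: nat
  assumes q: "q = CARD('a)"
    and k: "k = CARD('n)" "k \<ge> 2"
    and B: "bilinear_form B" "nondegenerate B"
    and Mbar: "set_of_points Mbar"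
    and r: "r = cardinality Mbar" "r \<notin> {0, qint q k}"
    and M: "M = (\<lambda>P. \<Sum>H\<in>hyperplanes. Mbar (perp_point B H) * chi (points_in H) P)"
    and \<mu>: "\<mu> = Min (M ` points)"
    and g: "g = Gcd {M P - \<mu> | P. P \<in> points}"
  shows
    "two_character M \<and>
     (r * qint q (k - 2) + q ^ (k - 2), r * qint q (k - 2)) \<in> LL B Mbar \<and>
     corresponds B Mbar M (r * qint q (k - 2) + q ^ (k - 2), r * qint q (k - 2)) \<and>
     cardinality M = r * qint q (k - 1) \<and>
     g dvd q ^ (k - 2) \<and>
     (\<exists>(M' :: ('a, 'n) point_multiset) (s0 :: nat) (t0 :: nat).
        (\<forall>P\<in>points. real (M' P) = 1 / real g * (real (M P) - real \<mu> * real (chi points P))) \<and>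
        real t0 = 1 / real g * (real r * real (qint q (k - 2)) - real \<mu> * real (qint q (k - 1))) \<and>
        real s0 = 1 / real g * (real r * real (qint q (k - 2)) - real \<mu> * real (qint q (k - 1))
                                + real q ^ (k - 2)) \<and>
        two_character M' \<and>
        (s0, t0) \<in> LL B Mbar \<and>
        corresponds B Mbar M' (s0, t0) \<and>
        real (cardinality M') =
          1 / real g * (real r * real (qint q (k - 1)) - real \<mu> * real (qint q k)) \<and>
        LL B Mbar =
          {(u * s0 + v * qint q (k - 1), u * t0 + v * qint q (k - 1)) | u v :: nat. True})"
proof -
  let ?B' = "\<lambda>x y. B y x"
  note B' = bilinear_flip[OF B(1)] nondegenerate_flip[OF B(2)]
  have n: "CARD('n) \<ge> 2"
    using k by simp
  have q_pos: "q ^ (k - 2) > 0"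
    by (simp add: q)
  define s t where "s = r * qint q (k - 2) + q ^ (k - 2)" and "t = r * qint q (k - 2)"
  have M_dual: "M P = dual_mult ?B' Mbar P" if "P \<in> points" for P
    unfolding M by (rule sum_hyperplanes_eq_dual_mult[OF B that])

  obtain P1 where P1: "P1 \<in> points" "Mbar P1 = 1"
  proof -
    have "\<exists>P\<in>points. Mbar P \<noteq> 0"
      using r by (auto simp: cardinality_def)
    then show ?thesis
      using that Mbar by (auto simp: set_of_points_def)
  qed
  obtain P0 where P0: "P0 \<in> points" "Mbar P0 = 0"
  proof -
    have "\<exists>P\<in>points. Mbar P \<noteq> 1"
    proof (rule ccontr)
      assume "\<not> ?thesis"
      then have "cardinality Mbar = card (points :: ('a ^ 'n) set set)"
        by (simp add: cardinality_def)
      then show False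
        using r by (simp add: card_points q k)
    qed
    then show ?thesis
      using that Mbar by (auto simp: set_of_points_def)
  qed

  have dual_M: "dual_mult B M P = (if Mbar P = 1 then s else t)" if P: "P \<in> points" for P
  proof -
    have "dual_mult B M P = dual_mult B (dual_mult ?B' Mbar) P"
      by (rule dual_mult_cong) (rule M_dual)
    also have "\<dots> = q ^ (k - 2) * Mbar P + t"
      using dual_mult_dual_mult[OF B n P] by (simp add: q k t_def r(1) mult.commute)
    finally show ?thesis
      using Mbar P by (auto simp: set_of_points_def s_def t_def)
  qed
  then have M_corr: "corresponds B Mbar M (s, t)"
    by (simp add: corresponds_iff_dual_mult[OF B Mbar])
  have st: "s > t"
    using q_pos by (simp add: s_def t_def)
  have "cardinality M = cardinality (dual_mult ?B' Mbar)"
    by (simp add: cardinality_def M_dual)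
  then have card_M: "cardinality M = r * qint q (k - 1)"
    by (simp add: cardinality_dual_mult[OF B'] q k r(1))

  have \<mu>_le: "\<mu> \<le> M P" if "P \<in> points" for P
    unfolding \<mu> using that by (intro Min_le) auto
  have "\<mu> \<in> M ` points"
    unfolding \<mu> using P1(1) by (intro Min_in) auto
  then obtain Pm where Pm: "Pm \<in> points" "M Pm = \<mu>"
    by auto
  define M' where "M' = (\<lambda>P. (M P - \<mu>) div g)"
  have "g dvd M P - \<mu>" if "P \<in> points" for P
    unfolding g using that by (intro Gcd_dvd) auto
  then have M_M': "M P = g * M' P + \<mu>" if "P \<in> points" for P
    using that \<mu>_le[OF that] by (simp add: M'_def)
  have scale: "dual_mult B M P = g * dual_mult B M' P + \<mu> * qint q (k - 1)" if P: "P \<in> points" for P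
    using dual_mult_cong[of M "\<lambda>P. g * M' P + \<mu>" B P] M_M' dual_mult_affine[OF B P]
    by (simp add: q k)
  \<comment> \<open>With \<open>g = 0\<close>, \<open>M\<close> would be constant on the points and have a single hyperplane value.\<close>
  have g_pos: "g > 0"
  proof (rule ccontr)
    assume "\<not> g > 0"
    then have "dual_mult B M P1 = dual_mult B M P0"
      using scale[OF P1(1)] scale[OF P0(1)] by simp
    then show False
      using dual_M[OF P1(1)] dual_M[OF P0(1)] P1(2) P0(2) st by simp
  qed
  have "{M P - \<mu> | P. P \<in> points} = (*) g ` (M' ` points)"
    using M_M' by (auto simp: image_iff intro!: exI)
  then have "g = g * Gcd (M' ` points)"
    by (subst (1) g) (simp add: Gcd_mult)
  then have Gcd: "Gcd (M' ` points) = 1"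
    using g_pos by simp

  \<comment> \<open>\<open>P1\<close> and \<open>P0\<close> represent the hyperplanes of the two kinds; reading the values of \<open>M'\<close> off them
    shows without any divisibility argument that \<open>s0\<close> and \<open>t0\<close> are natural numbers.\<close>
  define s0 t0 where "s0 = dual_mult B M' P1" and "t0 = dual_mult B M' P0"
  have s0: "s = g * s0 + \<mu> * qint q (k - 1)"
    using scale[OF P1(1)] dual_M[OF P1(1)] P1(2) by (simp add: s0_def)
  have t0: "t = g * t0 + \<mu> * qint q (k - 1)"
    using scale[OF P0(1)] dual_M[OF P0(1)] P0(2) by (simp add: t0_def)
  have s0_t0: "s0 > t0"
    using st g_pos by (simp add: s0 t0)
  have dual_M': "dual_mult B M' P = (if Mbar P = 1 then s0 else t0)" if P: "P \<in> points" for P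
    using scale[OF P] dual_M[OF P] g_pos by (auto simp: s0 t0 split: if_splits)
  then have M'_corr: "corresponds B Mbar M' (s0, t0)"
    by (simp add: corresponds_iff_dual_mult[OF B Mbar])
  have "g * t0 + q ^ (k - 2) = g * s0"
    using s0 t0 by (simp add: s_def t_def)
  then have g_dvd: "g dvd q ^ (k - 2)"
    by (metis dvd_add_right_iff dvd_triv_left)
  have card_M': "cardinality M = g * cardinality M' + \<mu> * qint q k"
    by (simp add: cardinality_def M_M' sum.distrib sum_distrib_left card_points q k)

  have LL: "LL B Mbar = {(u * s0 + v * qint q (k - 1), u * t0 + v * qint q (k - 1)) | u v. True}"
  proof (intro equalityI subsetI)
    fix p assume "p \<in> LL B Mbar"
    then obtain s' t' N where p: "p = (s', t')" "s' \<ge> t'" and N: "corresponds B Mbar N (s', t')"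
      by (auto simp: LL_def)
    have "M' Pm = 0"
      using M_M'[OF Pm(1)] Pm(2) g_pos by simp
    from corresponds_imp_affine[OF B n Mbar _ Pm(1) this Gcd N p(2), of g \<mu>]
    obtain u v where uv: "\<And>P. P \<in> points \<Longrightarrow> N P = u * M' P + v"
      using M_M' M_dual by metis
    have "dual_mult B N P = u * dual_mult B M' P + v * qint q (k - 1)" if "P \<in> points" for P
      using dual_mult_cong[of N "\<lambda>P. u * M' P + v" B P] uv dual_mult_affine[OF B that]
      by (simp add: q k)
    from this[OF P1(1)] this[OF P0(1)]
    show "p \<in> {(u * s0 + v * qint q (k - 1), u * t0 + v * qint q (k - 1)) | u v. True}"
      using N P1 P0 by (auto simp: p corresponds_iff_dual_mult[OF B Mbar] s0_def t0_def)
  next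
    fix p assume "p \<in> {(u * s0 + v * qint q (k - 1), u * t0 + v * qint q (k - 1)) | u v. True}"
    then obtain u v where p: "p = (u * s0 + v * qint q (k - 1), u * t0 + v * qint q (k - 1))"
      by blast
    have "corresponds B Mbar (\<lambda>P. u * M' P + v) p"
      unfolding p by (simp add: corresponds_iff_dual_mult[OF B Mbar] dual_mult_affine[OF B] dual_M' q k)
    then show "p \<in> LL B Mbar"
      using s0_t0 by (auto simp: LL_def p)
  qed

  have "real t = real g * real t0 + real \<mu> * real (qint q (k - 1))"
    "real s = real g * real s0 + real \<mu> * real (qint q (k - 1))"
    "real (cardinality M) = real g * real (cardinality M') + real \<mu> * real (qint q k)"
    using s0 t0 card_M' by simp_all
  then have reals:
    "real t0 = 1 / real g * (real r * real (qint q (k - 2)) - real \<mu> * real (qint q (k - 1)))"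
    "real s0 = 1 / real g * (real r * real (qint q (k - 2)) - real \<mu> * real (qint q (k - 1))
      + real q ^ (k - 2))"
    "real (cardinality M') = 1 / real g * (real r * real (qint q (k - 1)) - real \<mu> * real (qint q k))"
    using g_pos by (simp_all add: s_def t_def card_M field_simps)
  have M'_real: "\<forall>P\<in>points. real (M' P) = 1 / real g * (real (M P) - real \<mu> * real (chi points P))"
    using g_pos by (simp add: M_M' chi_def)
  have "two_character M" "two_character M'"
    using corresponds_two_character[OF B Mbar P1 P0] M_corr M'_corr st s0_t0 by auto
  moreover have "(s, t) \<in> LL B Mbar" "(s0, t0) \<in> LL B Mbar"
    using M_corr M'_corr st s0_t0 by (auto simp: LL_def)
  ultimately show ?thesis
    using M_corr M'_corr card_M g_dvd M'_real reals LL unfolding s_def t_def by blast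
qed

end
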